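(* (1) $\mathrm{PL}_2(0.7666)$ is false. (2) For any $c>0$, if $\mathrm{PL}_2(0.5+c)$ is true, then any square-difference-free subset of $[N]$ has size at most $N^{1-c+o(1)}$, where $o(1)\to 0$ as $N\to\infty$.
   Context: $[N]=\{1,\dots,N\}$. A set $A\subset\mathbb{Z}$ is square-difference-free if for any distinct $a,a'\in A$ the difference $a-a'$ is not a perfect square. For a point $p$ and a line $\ell$ in $\mathbb{R}^d$, $d_\infty(p,\ell)=\min_{q\in\ell}\|p-q\|_\infty$. For an integer $d\ge 2$ and $0\le\gamma<d$, $\mathrm{PL}_d(\gamma)$ is the following proposition: for every large $n$ and any points $p_1,\dots,p_n\in[0,1]^d$ and lines $\ell_1,\dots,\ell_n$ in $\mathbb{R}^d$ with $p_i\in\ell_i$, there exist $i\ne j$ with $d_\infty(p_i,\ell_j)\le n^{-\frac{1}{d-\gamma}+o(1)}$. Here $o(1)$ denotes a quantity tending to $0$ as $n\to\infty$, uniformly over all configurations; i.e. for every $\epsilon>0$ there is $n_0$ such that for all $n\ge n_0$ and all such configurations there exist $i\neq j$ with $d_\infty(p_i,\ell_j)\le n^{-\frac{1}{d-\gamma}+\epsilon}$. *)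

theory Defs
  imports "HOL-Analysis.Analysis" "HOL-Computational_Algebra.Nth_Powers"
begin

definition square_difference_free :: "int set \<Rightarrow> bool" where
  "square_difference_free A \<longleftrightarrow> (\<forall>a\<in>A. \<forall>a'\<in>A. a \<noteq> a' \<longrightarrow> \<not> is_square (a - a'))"

definition is_line :: "(real ^ 'd) set \<Rightarrow> bool" where
  "is_line l \<longleftrightarrow> affine l \<and> aff_dim l = 1"

(* The infimum is attained when l is a line, so this is the minimum there. *)
definition dist_inf :: "real ^ 'd \<Rightarrow> (real ^ 'd) set \<Rightarrow> real" where
  "dist_inf p l = (INF q\<in>l. infnorm (p - q))"

(* The dimension d is CARD('d).  The proposition is only meaningful for
   0 \<le> \<gamma> < d: the exponent degenerates to \<epsilon> at \<gamma> = d because 1 / 0 = 0, and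
   its main term is positive beyond that.  The range is not built into the
   definition; uses have to respect it. *)
definition PL :: "'d::finite itself \<Rightarrow> real \<Rightarrow> bool" where
  "PL (_ :: 'd itself) \<gamma> \<longleftrightarrow>
     (\<forall>\<epsilon>>0. \<exists>n0. \<forall>n\<ge>n0. \<forall>(p :: nat \<Rightarrow> real ^ 'd) (l :: nat \<Rightarrow> (real ^ 'd) set).
        (\<forall>i\<in>{1..n}. (\<forall>k. p i $ k \<in> {0..1}) \<and> is_line (l i) \<and> p i \<in> l i) \<longrightarrow>
        (\<exists>i\<in>{1..n}. \<exists>j\<in>{1..n}. i \<noteq> j \<and>
           dist_inf (p i) (l j) \<le> real n powr (- 1 / (real CARD('d) - \<gamma>) + \<epsilon>)))"

end

theory Submission
  imports Defs "HOL-Computational_Algebra.Squarefree" "HOL-Real_Asymp.Real_Asymp"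
begin

text \<open>
  Draw the translate by $(0, a)$ of the parabola $y = x^2$ for every $a \<in> A$, and take the integer
  points on these parabolas together with their tangents.  The vertical distance from the point
  $(x, x^2 + a)$ to the tangent at $(x', x'^2 + a')$ is $|(x - x')^2 + a - a'|$, a nonzero integer
  when $A$ is square-difference-free.  Rescaling $x \<le> \<surd>N$ and $y \<le> 2N$ to the unit square gives
  about $\<surd>N\,|A|$ points, each at distance of order at least $1/N$ from the other tangents,
  whence (2).

  For (1), Ruzsa's construction lifts a set $R$ of residues modulo a squarefree $m$, no two of which
  differ by a square, to the integers whose base-$m$ digits in even positions lie in $R$; this has
  exponent $(1 + \log |R| / \log m)/2$.  Lewko's set of 12 residues modulo 205 gives an exponent above
  $0.7334$, contradicting (2) for $c = 0.2666$.
\<close>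

section \<open>Tangents of parabolas\<close>

lemma is_line_affine_hull_2: "a \<noteq> b \<Longrightarrow> is_line (affine hull {a, b})"
  by (simp add: is_line_def)

text \<open>The functional \<open>(u, v) \<mapsto> v - m * u\<close> vanishes on the direction
  \<open>(1, m)\<close>, hence takes the same value at \<open>p - z\<close> for every
  \<open>z\<close> on the line, and it is at most \<open>1 + \<bar>m\<bar>\<close> times the sup
  norm.\<close>

lemma vertical_distance_le_dist_inf:
  fixes p q :: "real ^ 2"
  shows "\<bar>p $ 2 - q $ 2 - m * (p $ 1 - q $ 1)\<bar>
    \<le> (1 + \<bar>m\<bar>) * dist_inf p (affine hull {q, q + vector [1, m]})"
proof -
  let ?d = "p $ 2 - q $ 2 - m * (p $ 1 - q $ 1)"
  have "\<bar>?d\<bar> / (1 + \<bar>m\<bar>) \<le> dist_inf p (affine hull {q, q + vector [1, m]})"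
    unfolding dist_inf_def
  proof (rule cINF_greatest)
    fix z assume "z \<in> affine hull {q, q + vector [1, m]}"
    then obtain t where z: "z = q + t *\<^sub>R vector [1, m]"
      by (auto simp: affine_hull_2_alt)
    let ?u = "(p - z) $ 1" and ?v = "(p - z) $ 2"
    have "?d = ?v - m * ?u"
      by (simp add: z algebra_simps)
    then have "\<bar>?d\<bar> \<le> \<bar>?v\<bar> + \<bar>m\<bar> * \<bar>?u\<bar>"
      by (metis abs_mult abs_triangle_ineq4)
    also have "\<dots> \<le> infnorm (p - z) + \<bar>m\<bar> * infnorm (p - z)"
      by (intro add_mono mult_left_mono component_le_infnorm_cart) auto
    finally show "\<bar>?d\<bar> / (1 + \<bar>m\<bar>) \<le> infnorm (p - z)"
      by (simp add: divide_simps algebra_simps)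
  qed simp
  then show ?thesis
    by (simp add: pos_divide_le_eq add_pos_nonneg mult.commute)
qed

text \<open>A vanishing value would make \<open>a' - a\<close> a square, forcing
  \<open>a = a'\<close> and then \<open>x = x'\<close>. An integer that is not 0 has absolute value
  at least 1.\<close>

lemma square_difference_free_separated:
  assumes A: "square_difference_free A" "a \<in> A" "a' \<in> A" and ne: "(x, a) \<noteq> (x', a')"
  shows "1 \<le> \<bar>(x - x')\<^sup>2 + a - a'\<bar>"
proof -
  have "(x - x')\<^sup>2 + a - a' \<noteq> 0"
  proof
    assume eq: "(x - x')\<^sup>2 + a - a' = 0"
    then have "a' - a = (x - x')\<^sup>2"
      by simp
    then have "is_square (a' - a)"
      by (auto intro: is_nth_powerI)
    with A have "a = a'"
      by (auto simp: square_difference_free_def)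
    with eq ne show False
      by simp
  qed
  then show ?thesis
    by linarith
qed

lemma separated_point_line_configuration:
  fixes N X :: nat
  assumes A: "A \<subseteq> {1..int N}" "square_difference_free A" and X: "X\<^sup>2 \<le> N" "0 < X"
  obtains p :: "nat \<Rightarrow> real ^ 2" and l where
    "\<And>i. i \<in> {1..X * card A} \<Longrightarrow> (\<forall>k. p i $ k \<in> {0..1}) \<and> is_line (l i) \<and> p i \<in> l i"
    "\<And>i j. i \<in> {1..X * card A} \<Longrightarrow> j \<in> {1..X * card A} \<Longrightarrow> i \<noteq> j \<Longrightarrow>
       1 / (4 * real N) \<le> dist_inf (p i) (l j)"
proof -
  have N: "0 < N"
    using X by (metis gr0I le_zero_eq power_eq_0_iff)
  define I where "I = {1..int X} \<times> A"
  have "finite A"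
    using A(1) finite_subset by blast
  then have "finite I" and "card I = X * card A"
    by (simp_all add: I_def card_cartesian_product)
  then obtain h where h: "bij_betw h {1..X * card A} I"
    using ex_bij_betw_nat_finite_1 by metis
  define P :: "int \<times> int \<Rightarrow> real ^ 2" where
    "P = (\<lambda>(x, a). vector [x / X, (x\<^sup>2 + a) / (2 * N)])"
  \<comment> \<open>The tangent slope \<open>2 * x\<close> becomes \<open>x * X / N\<close> after
    the first coordinate is divided by \<open>X\<close> and the second by \<open>2 * N\<close>.
    Since \<open>x \<le> X\<close> and \<open>X^2 \<le> N\<close>, it lies in [0, 1].\<close>
  define m where "m = (\<lambda>(x :: int, a :: int). real_of_int x * X / N)"
  define L where "L v = affine hull {P v, P v + vector [1, m v]}" for v
  have range: "1 \<le> x" "x \<le> X" "x\<^sup>2 \<le> N" "1 \<le> a" "a \<le> N" "x * X \<le> N" if "(x, a) \<in> I" for x a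
  proof -
    from that A(1) show x: "1 \<le> x" "x \<le> X" "1 \<le> a" "a \<le> N"
      by (auto simp: I_def)
    have "int X * X \<le> N"
      using X(1) by (metis of_nat_le_iff of_nat_mult power2_eq_square)
    moreover have "x * X \<le> int X * X" "x * x \<le> int X * X"
      using x by (auto intro!: mult_mono)
    ultimately show "x\<^sup>2 \<le> N" "x * X \<le> N"
      by (auto simp: power2_eq_square)
  qed
  have P: "(\<forall>k. P v $ k \<in> {0..1}) \<and> is_line (L v) \<and> P v \<in> L v" if "v \<in> I" for v
  proof -
    obtain x a where v: "v = (x, a)"
      by fastforce
    note r = range[OF that[unfolded v]]
    have "real_of_int (x\<^sup>2 + a) \<le> real_of_int (2 * N)" "0 \<le> real_of_int (x\<^sup>2 + a)"
      using r by (simp_all only: of_int_le_iff of_int_0_le_iff) auto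
    then have "\<forall>k. P v $ k \<in> {0..1}"
      using r X(2) N by (simp add: v P_def forall_2)
    moreover have "(vector [1, m v] :: real ^ 2) \<noteq> 0"
      by (metis vector_2(1) zero_index zero_neq_one)
    ultimately show ?thesis
      by (simp add: L_def is_line_affine_hull_2 hull_inc)
  qed
  have sep: "1 / (4 * real N) \<le> dist_inf (P v) (L w)" if "v \<in> I" "w \<in> I" "v \<noteq> w" for v w
  proof -
    obtain x a x' a' where v: "v = (x, a)" and w: "w = (x', a')"
      by fastforce
    have "m w = real_of_int (x' * X) / N"
      by (simp add: m_def w)
    moreover have "real_of_int (x' * X) \<le> real N" "0 \<le> real_of_int (x' * X)"
      using range[OF that(2)[unfolded w]] by (simp_all only: of_int_le_iff of_int_0_le_iff) auto
    ultimately have m: "0 \<le> m w" "m w \<le> 1"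
      using N by simp_all
    \<comment> \<open>Completing the square:
      \<open>x^2 - x'^2 - 2 * x' * (x - x') = (x - x')^2\<close>.\<close>
    have "P v $ 2 - P w $ 2 - m w * (P v $ 1 - P w $ 1) = real_of_int ((x - x')\<^sup>2 + a - a') / (2 * N)"
      using X(2) N by (simp add: P_def v w m_def field_simps power2_eq_square)
    then have "\<bar>real_of_int ((x - x')\<^sup>2 + a - a') / (2 * N)\<bar> \<le> (1 + \<bar>m w\<bar>) * dist_inf (P v) (L w)"
      unfolding L_def by (metis vertical_distance_le_dist_inf)
    moreover have "1 \<le> \<bar>(x - x')\<^sup>2 + a - a'\<bar>"
      using that A(2) by (intro square_difference_free_separated) (auto simp: v w I_def)
    then have "1 / (2 * N) \<le> \<bar>real_of_int ((x - x')\<^sup>2 + a - a') / (2 * N)\<bar>"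
      using N by (simp add: abs_divide divide_right_mono del: of_int_add of_int_diff flip: of_int_abs)
    ultimately have *: "1 / (2 * N) \<le> (1 + m w) * dist_inf (P v) (L w)"
      unfolding abs_of_nonneg[OF m(1)] by (rule order_trans[rotated])
    moreover have "0 < 1 / (2 * real N)"
      using N by simp
    ultimately have "0 < (1 + m w) * dist_inf (P v) (L w)"
      by linarith
    \<comment> \<open>The sign of the distance is read off from the lower bound just proved; it
      permits replacing the factor \<open>1 + m w\<close> by 2, which turns 1/(2N) into
      1/(4N).\<close>
    then have "0 \<le> dist_inf (P v) (L w)"
      using m(1) by (simp add: zero_less_mult_iff)
    then have "(1 + m w) * dist_inf (P v) (L w) \<le> 2 * dist_inf (P v) (L w)"
      using m(2) by (intro mult_right_mono) auto
    with * show ?thesis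
      by (simp add: field_simps)
  qed
  have I: "h i \<in> I" if "i \<in> {1..X * card A}" for i
    using h that by (auto simp: bij_betw_def)
  show ?thesis
  proof (rule that[of "\<lambda>i. P (h i)" "\<lambda>i. L (h i)"])
    fix i j assume ij: "i \<in> {1..X * card A}" "j \<in> {1..X * card A}" "i \<noteq> j"
    then have "h i \<noteq> h j"
      using bij_betw_imp_inj_on[OF h] by (simp only: inj_on_eq_iff not_False_eq_True)
    then show "1 / (4 * real N) \<le> dist_inf (P (h i)) (L (h j))"
      using I ij by (intro sep)
  qed (use P I in blast)
qed

text \<open>A set violating the bound yields at least \<open>N powr (s + \<epsilon>) / 2\<close>
  points, where \<open>s = 2 - (1/2 + c)\<close>. The proposition then gives a distance of order
  o(1/N), against the separation 1/(4N). The bound on \<open>c\<close> keeps \<open>1/2 + c\<close>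
  below the dimension 2.\<close>

theorem PL_imp_square_difference_free_bound:
  assumes c: "c < 3 / 2" and PL: "PL TYPE(2) (1 / 2 + c)" and eps: "0 < \<epsilon>"
  shows "\<exists>N0. \<forall>N\<ge>N0. \<forall>A \<subseteq> {1..int N}. square_difference_free A \<longrightarrow>
    real (card A) \<le> real N powr (1 - c + \<epsilon>)"
proof -
  define s where "s = 3 / 2 - c"
  \<comment> \<open>Chosen so that
    \<open>(s + \<epsilon>) * \<delta> = \<epsilon> / (2 * s)\<close>: half of the gain
    \<open>\<epsilon> / s\<close> over the exponent -1 is spent on the error term and half
    remains.\<close>
  define \<delta> where "\<delta> = \<epsilon> / (2 * s * (s + \<epsilon>))"
  have s_eq: "s + \<epsilon> = 1 / 2 + (1 - c + \<epsilon>)"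
    by (simp add: s_def)
  have s: "0 < s"
    using c by (simp add: s_def)
  have \<delta>: "0 < \<delta>" and exponent: "(s + \<epsilon>) * (- 1 / s + \<delta>) = - 1 - \<epsilon> / (2 * s)"
    using s eps by (simp_all add: \<delta>_def divide_simps)
  then have neg: "- 1 / s + \<delta> < 0"
    using s eps by (smt (verit) divide_nonneg_pos mult_nonneg_nonneg)
  have "real CARD(2) - (1 / 2 + c) = s"
    by (simp add: s_def)
  with PL \<delta> obtain n0 where n0: "\<forall>n\<ge>n0. \<forall>(p :: nat \<Rightarrow> real ^ 2) l.
      (\<forall>i\<in>{1..n}. (\<forall>k. p i $ k \<in> {0..1}) \<and> is_line (l i) \<and> p i \<in> l i) \<longrightarrow>
      (\<exists>i\<in>{1..n}. \<exists>j\<in>{1..n}. i \<noteq> j \<and> dist_inf (p i) (l j) \<le> real n powr (- 1 / s + \<delta>))"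
    unfolding PL_def by metis
  have "\<forall>\<^sub>F N :: nat in sequentially.
      (1 / 2) powr (- 1 / s + \<delta>) * real N powr (- \<epsilon> / (2 * s)) < 1 / 4"
    using s eps by real_asymp
  moreover have "\<forall>\<^sub>F N :: nat in sequentially. real n0 < sqrt N / 2"
    by real_asymp
  moreover have "\<forall>\<^sub>F N :: nat in sequentially. 4 \<le> N"
    by (rule eventually_ge_at_top)
  ultimately have "\<forall>\<^sub>F N :: nat in sequentially. \<forall>A \<subseteq> {1..int N}. square_difference_free A \<longrightarrow>
      real (card A) \<le> real N powr (1 - c + \<epsilon>)"
  proof eventually_elim
    case (elim N)
    show ?case
    proof (intro allI impI, rule ccontr)
      fix A assume A: "A \<subseteq> {1..int N}" "square_difference_free A"
        and "\<not> real (card A) \<le> real N powr (1 - c + \<epsilon>)"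
      then have card: "real N powr (1 - c + \<epsilon>) < real (card A)"
        by simp
      define X where "X = nat \<lfloor>sqrt N\<rfloor>"
      define n where "n = X * card A"
      \<comment> \<open>From 2 on, rounding down loses at most half of the value.\<close>
      have sqrt: "2 \<le> sqrt N"
        using elim(3) by (simp add: real_le_rsqrt)
      then have X: "real X \<le> sqrt N" "sqrt N / 2 \<le> real X"
        unfolding X_def by linarith+
      have "real (X\<^sup>2) \<le> (sqrt N)\<^sup>2"
        unfolding of_nat_power by (rule power_mono[OF X(1)]) simp
      then have "X\<^sup>2 \<le> N"
        by simp
      moreover have "0 < X"
        using X(2) sqrt by linarith
      ultimately obtain p :: "nat \<Rightarrow> real ^ 2" and l where
          pl: "\<And>i. i \<in> {1..n} \<Longrightarrow> (\<forall>k. p i $ k \<in> {0..1}) \<and> is_line (l i) \<and> p i \<in> l i"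
        and sep: "\<And>i j. i \<in> {1..n} \<Longrightarrow> j \<in> {1..n} \<Longrightarrow> i \<noteq> j \<Longrightarrow>
          1 / (4 * real N) \<le> dist_inf (p i) (l j)"
        using separated_point_line_configuration[OF A] unfolding n_def by metis
      have "real N powr (s + \<epsilon>) / 2 = sqrt N / 2 * real N powr (1 - c + \<epsilon>)"
        unfolding s_eq powr_add[of _ "1 / 2"] by (simp add: powr_half_sqrt)
      also have "\<dots> \<le> real n"
        unfolding n_def of_nat_mult using X card by (intro mult_mono) auto
      finally have n: "real N powr (s + \<epsilon>) / 2 \<le> real n" .
      have "card A \<noteq> 0"
        using card by (smt (verit) of_nat_0 powr_ge_zero)
      then have "X \<le> n"
        by (simp add: n_def)
      then have "n0 \<le> n"
        using X(2) elim(2) by linarith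
      then obtain i j where "i \<in> {1..n}" "j \<in> {1..n}" "i \<noteq> j"
        and "dist_inf (p i) (l j) \<le> real n powr (- 1 / s + \<delta>)"
        using n0[rule_format, of n p l] pl by blast
      then have "1 / (4 * real N) \<le> real n powr (- 1 / s + \<delta>)"
        using sep by fastforce
      \<comment> \<open>The exponent is negative, so the lower bound on \<open>n\<close> becomes an
        upper bound on its power.\<close>
      also have "\<dots> \<le> (real N powr (s + \<epsilon>) / 2) powr (- 1 / s + \<delta>)"
        using n neg elim(3) by (intro powr_mono2') auto
      also have "\<dots> = (1 / 2) powr (- 1 / s + \<delta>) * real N powr (- 1 - \<epsilon> / (2 * s))"
        by (simp only: powr_divide powr_powr exponent powr_one_eq_one powr_ge_zero) simp
      also have "\<dots> = (1 / 2) powr (- 1 / s + \<delta>) * real N powr (- \<epsilon> / (2 * s)) / N"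
        using elim(3) by (simp add: powr_diff powr_minus_divide)
      also have "\<dots> < 1 / 4 / N"
        using elim by (intro divide_strict_right_mono) auto
      finally show False
        by simp
    qed
  qed
  then show ?thesis
    by (simp add: eventually_sequentially)
qed

section \<open>Ruzsa's construction\<close>

text \<open>Each prime factor of \<open>m\<close> occurs only once and, dividing \<open>z^2\<close>,
  divides \<open>z\<close>; comparing multiplicities suffices.\<close>

lemma squarefree_dvd_power2_imp_dvd:
  fixes m z :: int
  assumes "squarefree m" "m dvd z\<^sup>2"
  shows "m dvd z"
proof (cases "z = 0")
  case False
  have m: "m \<noteq> 0"
    using assms(1) by auto
  have "multiplicity p m \<le> multiplicity p z" if p: "prime p" for p
  proof (cases "p dvd m")
    case True
    then have "p dvd z"
      using assms(2) p by (meson dvd_trans prime_dvd_power)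
    then have "1 \<le> multiplicity p z"
      using prime_multiplicity_gt_zero_iff[OF prime_imp_prime_elem[OF p] False] by simp
    moreover have "multiplicity p m \<le> 1"
      using assms(1) m p by (simp add: squarefree_factorial_semiring'')
    ultimately show ?thesis
      by simp
  qed (simp add: not_dvd_imp_multiplicity_0)
  with m False show ?thesis
    by (simp add: prime_multiplicity_le_imp_dvd)
qed simp

text \<open>Every step puts a pair of base-\<open>m\<close> digits below the earlier ones: a lowest
  digit from \<open>R\<close> and a free digit above it. This order suits the descent modulo
  \<open>m\<close> that excludes square differences.\<close>

fun ruzsa_set :: "int \<Rightarrow> int set \<Rightarrow> nat \<Rightarrow> int set" where
  "ruzsa_set m R 0 = {0}"
| "ruzsa_set m R (Suc k) = (\<lambda>(r, d, s). r + m * d + m\<^sup>2 * s) ` (R \<times> {0..<m} \<times> ruzsa_set m R k)"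

lemma ruzsa_digits_eq:
  fixes m :: int
  assumes m: "0 < m" and r: "r \<in> {0..<m}" "r' \<in> {0..<m}" and d: "d \<in> {0..<m}" "d' \<in> {0..<m}"
    and eq: "r + m * d + m\<^sup>2 * s = r' + m * d' + m\<^sup>2 * s'"
  shows "r = r' \<and> d = d' \<and> s = s'"
proof -
  have "(r + m * (d + m * s)) mod m = (r' + m * (d' + m * s')) mod m"
    using eq by (simp add: algebra_simps power2_eq_square)
  then have "r = r'"
    using r by simp
  then have "m * (d + m * s) = m * (d' + m * s')"
    using eq by (simp add: algebra_simps power2_eq_square)
  then have e: "d + m * s = d' + m * s'"
    using m by simp
  then have "(d + m * s) mod m = (d' + m * s') mod m"
    by simp
  then have "d = d'"
    using d by simp
  with \<open>r = r'\<close> e m show ?thesis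
    by simp
qed

lemma card_ruzsa_set:
  assumes "0 < m" "R \<subseteq> {0..<m}"
  shows "card (ruzsa_set m R k) = (card R * nat m) ^ k"
proof (induction k)
  case (Suc k)
  have "inj_on (\<lambda>(r, d, s). r + m * d + m\<^sup>2 * s) (R \<times> {0..<m} \<times> ruzsa_set m R k)"
    using assms by (auto simp: inj_on_def dest!: ruzsa_digits_eq[rotated 5])
  then show ?case
    using Suc by (simp add: card_image card_cartesian_product)
qed simp

lemma ruzsa_set_subset:
  assumes "0 < m" "R \<subseteq> {0..<m}"
  shows "ruzsa_set m R k \<subseteq> {0..<m ^ (2 * k)}"
proof (induction k)
  case (Suc k)
  have "r + m * d + m\<^sup>2 * s \<in> {0..<m ^ (2 * Suc k)}"
    if "r \<in> R" "d \<in> {0..<m}" "s \<in> ruzsa_set m R k" for r d s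
  proof -
    have s: "0 \<le> s" "s \<le> m ^ (2 * k) - 1" and r: "0 \<le> r" "r \<le> m - 1" and d: "0 \<le> d" "d \<le> m - 1"
      using that assms Suc by auto
    have "m * d \<le> m * (m - 1)" "m\<^sup>2 * s \<le> m\<^sup>2 * (m ^ (2 * k) - 1)"
      using s d assms by (auto intro!: mult_left_mono)
    then have "r + m * d + m\<^sup>2 * s \<le> m ^ (2 * Suc k) - 1"
      using r by (simp add: algebra_simps power2_eq_square)
    then show ?thesis
      using s r d assms by simp
  qed
  then show ?case
    by auto
qed simp

text \<open>If a difference is \<open>z^2\<close>, reduction modulo \<open>m\<close> gives
  \<open>r = r'\<close> by the choice of \<open>R\<close>. Then \<open>m\<close> divides
  \<open>z^2\<close>, hence \<open>z\<close>, so \<open>m^2\<close> divides \<open>z^2\<close> and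
  the free digits agree too. Dividing by \<open>m^2\<close> leaves \<open>s - s'\<close> as a
  square, and induction applies.\<close>

lemma square_difference_free_ruzsa_set:
  fixes m :: int
  assumes m: "0 < m" "squarefree m" and R: "R \<subseteq> {0..<m}"
    and nonsquare: "\<And>r r' z. r \<in> R \<Longrightarrow> r' \<in> R \<Longrightarrow> m dvd z\<^sup>2 - (r - r') \<Longrightarrow> r = r'"
  shows "square_difference_free (ruzsa_set m R k)"
proof (induction k)
  case (Suc k)
  have "r + m * d + m\<^sup>2 * s = r' + m * d' + m\<^sup>2 * s'"
    if r: "r \<in> R" "r' \<in> R" and d: "d \<in> {0..<m}" "d' \<in> {0..<m}"
      and s: "s \<in> ruzsa_set m R k" "s' \<in> ruzsa_set m R k"
      and z: "r + m * d + m\<^sup>2 * s - (r' + m * d' + m\<^sup>2 * s') = z\<^sup>2"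
    for r d s r' d' s' z
  proof -
    have z': "z\<^sup>2 - (r - r') = m * (d - d' + m * (s - s'))"
      unfolding z[symmetric] by (simp add: algebra_simps power2_eq_square)
    then have r_eq: "r = r'"
      by (rule nonsquare[OF r dvdI])
    with z' have z': "z\<^sup>2 = m * (d - d' + m * (s - s'))"
      by (simp only: diff_self diff_0_right)
    then have "m dvd z"
      by (rule squarefree_dvd_power2_imp_dvd[OF m(2) dvdI])
    then obtain y where y: "z = m * y" ..
    have "m * (d - d' + m * (s - s')) = m * (m * y\<^sup>2)"
      using z' by (simp only: y power_mult_distrib power2_eq_square[of m] mult.assoc)
    then have "d - d' + m * (s - s') = m * y\<^sup>2"
      using m(1) by (metis mult_cancel_left less_irrefl)
    then have y': "d - d' = m * (y\<^sup>2 - (s - s'))"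
      by (simp only: right_diff_distrib)
    then have "d mod m = d' mod m"
      by (simp add: mod_eq_dvd_iff)
    with d have [simp]: "d = d'"
      by simp
    with y' m have "s - s' = y\<^sup>2"
      by simp
    with Suc s have "s = s'"
      by (auto simp: square_difference_free_def is_nth_power_def)
    with r_eq show ?thesis
      by simp
  qed
  then show ?case
    unfolding square_difference_free_def is_nth_power_def by fastforce
qed (simp add: square_difference_free_def)

lemma square_difference_free_translate:
  "square_difference_free A \<Longrightarrow> square_difference_free ((+) t ` A)"
  by (auto simp: square_difference_free_def)

section \<open>Lewko's residues modulo 205\<close>

definition lewko_residues :: "int set" where
  "lewko_residues = {0, 2, 8, 14, 77, 79, 85, 96, 103, 109, 111, 181}"

lemma squarefree_205: "squarefree (205 :: int)"
proof -
  have "squarefree (5 * 41 :: int)"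
    by (intro squarefree_mult_coprime squarefree_prime) (simp_all add: primes_coprime)
  then show ?thesis
    by simp
qed

text \<open>A square modulo 205 is a square modulo 5 and modulo 41, and a finite check shows that no
  difference of distinct residues passes both tests.\<close>

lemma lewko_residues_nonsquare:
  assumes "r \<in> lewko_residues" "r' \<in> lewko_residues" "205 dvd z\<^sup>2 - (r - r')"
  shows "r = r'"
proof -
  \<comment> \<open>These are all 21 squares modulo 41, including 0.\<close>
  let ?Q = "{0, 1, 2, 4, 5, 8, 9, 10, 16, 18, 20, 21, 23, 25, 31, 32, 33, 36, 37, 39, 40} :: int set"
  have mod_eq: "(r - r') mod n = (z mod n)\<^sup>2 mod n" if "n dvd 205" for n
    using dvd_trans[OF that assms(3)] by (simp add: power_mod mod_eq_dvd_iff dvd_diff_commute)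
  have "\<forall>y\<in>set [0..4]. y\<^sup>2 mod 5 \<in> {0, 1, 4 :: int}" "\<forall>y\<in>set [0..40]. y\<^sup>2 mod 41 \<in> ?Q"
    by code_simp+
  moreover have "z mod 5 \<in> set [0..4]" "z mod 41 \<in> set [0..40]"
    using pos_mod_bound[of 5 z] pos_mod_bound[of 41 z] by auto
  ultimately have "(z mod 5)\<^sup>2 mod 5 \<in> {0, 1, 4}" "(z mod 41)\<^sup>2 mod 41 \<in> ?Q"
    by blast+
  moreover have "(r - r') mod 5 = (z mod 5)\<^sup>2 mod 5" "(r - r') mod 41 = (z mod 41)\<^sup>2 mod 41"
    by (rule mod_eq; simp)+
  ultimately have mods: "(r - r') mod 5 \<in> {0, 1, 4}" "(r - r') mod 41 \<in> ?Q"
    by (simp_all only:)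
  have "\<forall>r\<in>lewko_residues. \<forall>r'\<in>lewko_residues.
      (r - r') mod 5 \<in> {0, 1, 4} \<longrightarrow> (r - r') mod 41 \<in> ?Q \<longrightarrow> r = r'"
    unfolding lewko_residues_def by code_simp
  from this[rule_format, OF assms(1,2) mods] show ?thesis .
qed

lemma large_square_difference_free_set:
  obtains A where "A \<subseteq> {1..int (205 ^ (2 * k))}" "square_difference_free A" "card A = 2460 ^ k"
proof
  let ?S = "ruzsa_set 205 lewko_residues k"
  have R: "lewko_residues \<subseteq> {0..<205}"
    by (simp add: lewko_residues_def)
  \<comment> \<open>The construction starts at 0, so it is shifted by 1 to fit the interval.\<close>
  show "(+) 1 ` ?S \<subseteq> {1..int (205 ^ (2 * k))}"
    using ruzsa_set_subset[OF _ R, of k] by force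
  show "square_difference_free ((+) 1 ` ?S)"
    using R squarefree_205 lewko_residues_nonsquare
    by (intro square_difference_free_translate square_difference_free_ruzsa_set) auto
  have "card lewko_residues = 12"
    by (simp add: lewko_residues_def)
  then show "card ((+) 1 ` ?S) = 2460 ^ k"
    using card_ruzsa_set[OF _ R, of k] by (simp add: card_image flip: power_mult_distrib)
qed

section \<open>Comparison of exponents and failure of the planar proposition\<close>

lemma powr_divide_less:
  fixes a b :: real
  assumes "a ^ p < b ^ q" "0 < a" "0 \<le> b" "0 < q"
  shows "a powr (real p / real q) < b"
proof (rule power_less_imp_less_base)
  have "(a powr (real p / real q)) ^ q = a ^ p"
    using assms by (simp add: powr_power powr_realpow)
  then show "(a powr (real p / real q)) ^ q < b ^ q"
    using assms(1) by simp
qed fact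

text \<open>The fraction 204/437 lies between $2 \cdot 0.7334 - 1 = 0.4668$ and $\log 12 / \log 205$.
  Direct evaluation of the powers is slow; instead $205^7 < \frac{80}{81} \cdot 12^{15}$ is raised to
  the power 29, as $204 = 7 \cdot 29 + 1$ and $437 = 15 \cdot 29 + 2$.\<close>

lemma power_205_less_power_12: "(205 :: real) ^ 204 < 12 ^ 437"
proof -
  have split: "a ^ 204 = (a ^ 7) ^ 29 * a" "b ^ 437 = b\<^sup>2 * (b ^ 15) ^ 29" for a b :: real
    using power_add[of a 203 1] power_mult[of a 7 29] power_add[of b 2 435] power_mult[of b 15 29]
    by simp_all
  have "((205::real) ^ 7) ^ 29 \<le> (80 / 81 * 12 ^ 15) ^ 29"
    by (rule power_mono) simp_all
  then have "(205::real) ^ 204 \<le> (80 / 81) ^ 29 * 205 * (12 ^ 15) ^ 29"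
    unfolding split power_mult_distrib by linarith
  also have "\<dots> < 12\<^sup>2 * (12 ^ 15) ^ 29"
  proof (rule mult_strict_right_mono)
    show "(80 / 81 :: real) ^ 29 * 205 < 12\<^sup>2"
      by (simp add: power_divide)
  qed (rule zero_less_power, simp)
  also have "\<dots> = 12 ^ 437"
    by (rule split[symmetric])
  finally show ?thesis .
qed

text \<open>Each digit pair multiplies the size by \<open>2460 = 205 * 12\<close> and the range by
  \<open>205^2\<close>, so this makes the exponent of the construction exceed
  \<open>(1 + 204/437) / 2\<close>, itself just above 0.7334.\<close>

lemma powr_205_less_2460: "(205 :: real) powr (1 + 204 / 437) < 2460"
  using powr_divide_less[OF power_205_less_power_12] unfolding powr_add by simp

lemma not_PL_2: "\<not> PL TYPE(2) (1 / 2 + 0.2666)"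
proof
  assume "PL TYPE(2) (1 / 2 + 0.2666)"
  then have "\<exists>N0. \<forall>N\<ge>N0. \<forall>A \<subseteq> {1..int N}. square_difference_free A \<longrightarrow>
      real (card A) \<le> real N powr (1 - 0.2666 + ((1 + 204 / 437) / 2 - 0.7334))"
    by (intro PL_imp_square_difference_free_bound) simp_all
  then obtain N0 where N0: "\<And>N A. N0 \<le> N \<Longrightarrow> A \<subseteq> {1..int N} \<Longrightarrow> square_difference_free A \<Longrightarrow>
      real (card A) \<le> real N powr ((1 + 204 / 437) / 2)"
    by auto
  \<comment> \<open>Besides making the range exceed \<open>N0\<close>, this keeps \<open>k\<close>
    positive, so that the final comparison of powers is strict.\<close>
  define k where "k = Suc N0"
  have "N0 < 2 ^ N0"
    by (rule less_exp)
  also have "(2 :: nat) ^ N0 \<le> 205 ^ N0"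
    by (rule power_mono) auto
  also have "(205 :: nat) ^ N0 \<le> 205 ^ (2 * k)"
    by (rule power_increasing) (auto simp: k_def)
  finally have "N0 \<le> 205 ^ (2 * k)"
    by simp
  obtain A where A: "A \<subseteq> {1..int (205 ^ (2 * k))}" "square_difference_free A" "card A = 2460 ^ k"
    by (rule large_square_difference_free_set)
  have "2460 ^ k \<le> (205 ^ (2 * k)) powr ((1 + 204 / 437) / 2 :: real)"
    using N0[OF \<open>N0 \<le> _\<close> A(1,2)] A(3) by simp
  also have "\<dots> = (205 powr real (2 * k)) powr ((1 + 204 / 437) / 2)"
    by (subst powr_realpow) simp_all
  also have "\<dots> = ((205 :: real) powr (1 + 204 / 437)) powr real k"
    by (simp add: powr_powr)
  also have "\<dots> = ((205 :: real) powr (1 + 204 / 437)) ^ k"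
    by (simp add: powr_realpow)
  also have "\<dots> < 2460 ^ k"
    using powr_205_less_2460 by (intro power_strict_mono) (auto simp: k_def)
  finally show False
    by simp
qed

theorem corollary1p16:
  "\<not> PL TYPE(2) 0.7666 \<and>
   (\<forall>c::real. 0 < c \<and> 0.5 + c < 2 \<and> PL TYPE(2) (0.5 + c) \<longrightarrow>
      (\<forall>\<epsilon>>0. \<exists>N0. \<forall>N\<ge>N0. \<forall>A \<subseteq> {1..int N}. square_difference_free A \<longrightarrow>
         real (card A) \<le> real N powr (1 - c + \<epsilon>)))"
proof (intro conjI allI impI)
  show "\<not> PL TYPE(2) 0.7666"
    using not_PL_2 by simp
next
  fix c \<epsilon> :: real
  assume "0 < c \<and> 0.5 + c < 2 \<and> PL TYPE(2) (0.5 + c)" and "0 < \<epsilon>"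
  then show "\<exists>N0. \<forall>N\<ge>N0. \<forall>A \<subseteq> {1..int N}. square_difference_free A \<longrightarrow>
      real (card A) \<le> real N powr (1 - c + \<epsilon>)"
    by (intro PL_imp_square_difference_free_bound) simp_all
qed

end
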